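(* For every $n\geq 4$, the set of minimal forbidden factors of the circular Fibonacci word $[f_n]$ is $$\mathcal{M}_{[f_n]}=\{\hat{g}_{3},\hat{g}_{4},\ldots,\hat{g}_{n},\hat{f}_{n}\}.$$
   Context: The alphabet is $A=\{a,b\}$. The Fibonacci words are defined by $f_1=b$, $f_2=a$, and $f_n=f_{n-1}f_{n-2}$ for $n>2$. For $n\ge 3$, $u_n$ denotes the word obtained from $f_n$ by removing its last two letters; thus $f_n=u_nab$ if $n$ is odd and $f_n=u_nba$ if $n$ is even (e.g. $u_3=\varepsilon$, $u_4=a$, $u_5=aba$). For $n\ge 3$ define $\hat f_n=au_na$ if $n$ is odd and $\hat f_n=bu_nb$ if $n$ is even; $\hat g_n=bu_nb$ if $n$ is odd and $\hat g_n=au_na$ if $n$ is even. For a word $w$, the circular word $[w]$ is the conjugacy class of $w$ (the set of all rotations of $w$). Its set of factors is $\mathcal{F}_{w^*}$, the set of all words that are factors (contiguous subwords, including the empty word $\varepsilon$) of $w^k$ for some $k\ge0$; it does not depend on the chosen rotation. For a language $L$ closed under taking factors, the set of minimal forbidden factors is $$\mathcal{M}_L=\{x\in A\mid x\notin L\}\cup\{xuy\mid x,y\in A,\ u\in A^*,\ xuy\notin L,\ xu\in L,\ uy\in L\},$$ and $\mathcal{M}_{[w]}:=\mathcal{M}_{\mathcal{F}_{w^*}}$. *)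

theory Defs
  imports Main "HOL-Library.Sublist"
begin

datatype letter = LA | LB

text \<open>The Fibonacci words are indexed from 1; the value at 0 is arbitrary.\<close>

fun fib_word :: "nat \<Rightarrow> letter list" where
  "fib_word 0 = []"
| "fib_word (Suc 0) = [LB]"
| "fib_word (Suc (Suc 0)) = [LA]"
| "fib_word (Suc (Suc (Suc n))) = fib_word (Suc (Suc n)) @ fib_word (Suc n)"

definition fib_u :: "nat \<Rightarrow> letter list" where
  "fib_u n = butlast (butlast (fib_word n))"

definition hat_f :: "nat \<Rightarrow> letter list" where
  "hat_f n = (if odd n then [LA] @ fib_u n @ [LA] else [LB] @ fib_u n @ [LB])"

definition hat_g :: "nat \<Rightarrow> letter list" where
  "hat_g n = (if odd n then [LB] @ fib_u n @ [LB] else [LA] @ fib_u n @ [LA])"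

definition word_power :: "'a list \<Rightarrow> nat \<Rightarrow> 'a list" where
  "word_power w k = concat (replicate k w)"

text \<open>The circular word of \<open>w\<close> enters only through the factors of the powers of a
  representative; \<open>circ_factors_rotate\<close> below shows that the choice of representative is
  irrelevant.\<close>

definition circ_factors :: "'a list \<Rightarrow> 'a list set" where
  "circ_factors w = {x. \<exists>k. sublist x (word_power w k)}"

text \<open>The alphabet is the whole type \<open>'a\<close>.\<close>

definition min_forbidden :: "'a list set \<Rightarrow> 'a list set" where
  "min_forbidden L =
     {[x] | x. [x] \<notin> L} \<union>
     {[x] @ u @ [y] | x u y. [x] @ u @ [y] \<notin> L \<and> [x] @ u \<in> L \<and> u @ [y] \<in> L}"

definition circ_min_forbidden :: "'a list \<Rightarrow> 'a list set" where
  "circ_min_forbidden w = min_forbidden (circ_factors w)"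

lemma word_power_append_swap: "x @ word_power (y @ x) k = word_power (x @ y) k @ x"
  by (induction k) (auto simp: word_power_def)

lemma circ_factors_append_swap_subset: "circ_factors (y @ x) \<subseteq> circ_factors (x @ y)"
proof
  fix z assume "z \<in> circ_factors (y @ x)"
  then obtain k where k: "sublist z (word_power (y @ x) k)"
    by (auto simp: circ_factors_def)
  have "word_power (x @ y) (Suc k) = word_power (x @ y) k @ x @ y"
    by (induction k) (auto simp: word_power_def)
  also have "\<dots> = x @ word_power (y @ x) k @ y"
    using word_power_append_swap[of x y k] by (metis append.assoc)
  finally have "sublist (word_power (y @ x) k) (word_power (x @ y) (Suc k))"
    by (metis sublist_appendI)
  with k show "z \<in> circ_factors (x @ y)"
    unfolding circ_factors_def by (metis mem_Collect_eq sublist_order.order.trans)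
qed

lemma circ_factors_rotate: "circ_factors (rotate k w) = circ_factors w"
proof -
  obtain x y where "w = x @ y" "rotate k w = y @ x"
    by (metis append_take_drop_id rotate_drop_take)
  then show ?thesis
    by (metis circ_factors_append_swap_subset subset_antisym)
qed

lemma fib_word_ends:
  assumes "n \<ge> 3"
  shows "fib_word n = fib_u n @ (if odd n then [LA, LB] else [LB, LA])"
proof -
  have "\<exists>u. fib_word (n + 3) = u @ (if even n then [LA, LB] else [LB, LA])" for n
  proof (induction n rule: less_induct)
    case (less n)
    consider "n = 0" | "n = 1" | m where "n = Suc (Suc m)"
      by (metis One_nat_def not0_implies_Suc)
    then show ?case
    proof cases
      case 1
      then show ?thesis by (simp add: numeral_3_eq_3)
    next
      case 2
      then show ?thesis by (simp add: numeral_3_eq_3)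
    next
      case 3
      from less[of m] 3 obtain u
        where "fib_word (m + 3) = u @ (if even m then [LA, LB] else [LB, LA])" by auto
      moreover have "fib_word (n + 3) = fib_word (m + 4) @ fib_word (m + 3)"
        using 3 by (simp add: eval_nat_numeral)
      moreover have "even n \<longleftrightarrow> even m"
        using 3 by simp
      ultimately have "fib_word (n + 3) =
          (fib_word (m + 4) @ u) @ (if even n then [LA, LB] else [LB, LA])"
        by simp
      then show ?thesis by blast
    qed
  qed
  from this[of "n - 3"] assms obtain u
    where "fib_word n = u @ (if odd n then [LA, LB] else [LB, LA])" by auto
  then show ?thesis by (simp add: fib_u_def butlast_append)
qed

end

theory Submission
  imports Defs
begin

text \<open>Let \<open>\<phi>\<close> be the Fibonacci morphism \<open>a \<mapsto> ab\<close>, \<open>b \<mapsto> a\<close>, so that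
  \<open>f\<^sub>n\<^sub>+\<^sub>1 = \<phi>(f\<^sub>n)\<close> and \<open>u\<^sub>n\<^sub>+\<^sub>1 = \<phi>(u\<^sub>n)a\<close>. Every \<open>a\<close> in a product of the blocks \<open>ab\<close> and \<open>a\<close>
  starts a block, hence \<open>\<phi>(z)a\<close> is a factor of \<open>[\<phi>(w)]\<close> iff \<open>z\<close> is a factor of \<open>[w]\<close>. Moreover
  every \<open>b\<close> is surrounded by letters \<open>a\<close>. Therefore the minimal forbidden factors of
  \<open>[\<phi>(w)]\<close> other than \<open>bb\<close> (and \<open>aa\<close>, if \<open>b\<close> does not occur in \<open>w\<close>) are the words
  \<open>x\<phi>(u)ay\<close> where \<open>x'uy'\<close> is a minimal forbidden factor of \<open>[w]\<close> and the prime exchanges the two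
  letters. This step sends the \<open>n\<close>-th word of either hat family to the next one; the induction
  starts from \<open>f\<^sub>2 = a\<close>.\<close>

section \<open>The Fibonacci morphism and its action on Fibonacci words\<close>

fun flip :: "letter \<Rightarrow> letter" where
  "flip LA = LB"
| "flip LB = LA"

lemma flip_flip [simp]: "flip (flip x) = x"
  by (cases x) auto

lemma letter_neq_iff [simp]: "x \<noteq> LA \<longleftrightarrow> x = LB" "x \<noteq> LB \<longleftrightarrow> x = LA"
  by (cases x; simp)+

fun fib_morph :: "letter list \<Rightarrow> letter list" where
  "fib_morph [] = []"
| "fib_morph (LA # w) = LA # LB # fib_morph w"
| "fib_morph (LB # w) = LA # fib_morph w"

lemma fib_morph_append [simp]: "fib_morph (v @ w) = fib_morph v @ fib_morph w"
  by (induction v rule: fib_morph.induct) auto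

lemma fib_morph_eq_Nil_iff [simp]: "fib_morph w = [] \<longleftrightarrow> w = []"
  by (cases w rule: fib_morph.cases) auto

lemma fib_morph_word_power: "fib_morph (word_power w k) = word_power (fib_morph w) k"
  by (induction k) (auto simp: word_power_def)

lemma fib_morph_fib_word: "n \<ge> 1 \<Longrightarrow> fib_morph (fib_word n) = fib_word (Suc n)"
  by (induction n rule: fib_word.induct) auto

text \<open>The endings \<open>ab\<close> and \<open>ba\<close> are mapped to \<open>aba\<close> and
  \<open>aab\<close>; their common first letter \<open>a\<close> is what survives when two letters
  are dropped.\<close>

lemma fib_u_Suc:
  assumes "n \<ge> 3"
  shows "fib_u (Suc n) = fib_morph (fib_u n) @ [LA]"
proof -
  have "fib_word (Suc n) = fib_morph (fib_u n) @ fib_morph (if odd n then [LA, LB] else [LB, LA])"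
    using fib_word_ends[OF assms] fib_morph_fib_word[of n] assms by (metis fib_morph_append
        One_nat_def Suc_le_lessD Suc_lessD numeral_3_eq_3 less_imp_le)
  then show ?thesis
    by (auto simp: fib_u_def butlast_append)
qed

section \<open>Unique decoding of products of blocks\<close>

lemma fib_morph_eq_append_LA:
  assumes "fib_morph w = p @ LA # s"
  obtains p' s' where "w = p' @ s'" "fib_morph p' = p" "fib_morph s' = LA # s"
proof -
  have "\<exists>p' s'. w = p' @ s' \<and> fib_morph p' = p \<and> fib_morph s' = LA # s"
    using assms
  proof (induction w arbitrary: p)
    case Nil
    then show ?case by simp
  next
    case (Cons c w)
    show ?case
    proof (cases p)
      case Nil
      then show ?thesis using Cons.prems by (intro exI[of _ "[]"] exI[of _ "c # w"]) simp
    next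
      case (Cons d q)
      \<comment> \<open>A nonempty \<open>p\<close> contains the whole first block, since a cut
        inside \<open>ab\<close> would be followed by \<open>LB\<close>.\<close>
      then obtain q' where q': "p = fib_morph [c] @ q'" "fib_morph w = q' @ LA # s"
        using Cons.prems by (cases c; cases q) auto
      from Cons.IH[OF q'(2)] obtain p' s'
        where "w = p' @ s'" "fib_morph p' = q'" "fib_morph s' = LA # s" by blast
      then show ?thesis
        using q'(1) fib_morph_append[of "[c]" p']
        by (intro exI[of _ "c # p'"] exI[of _ s']) simp
    qed
  qed
  then show ?thesis using that by blast
qed

text \<open>The \<open>LA\<close> after \<open>fib_morph z\<close> closes the last block of
  \<open>z\<close>; without it, the image of \<open>LB\<close> would also be a prefix of the image
  of \<open>LA\<close>.\<close>

lemma fib_morph_append_LA_prefix: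
  "fib_morph w = fib_morph z @ LA # s \<Longrightarrow> prefix z w"
proof (induction z arbitrary: w)
  case Nil
  then show ?case by simp
next
  case (Cons c z)
  show ?case
  proof (cases w)
    case Nil
    then show ?thesis using Cons.prems by (cases c) auto
  next
    case w: (Cons d w')
    have not_LB: "fib_morph v \<noteq> LB # t" for v t
      by (cases v rule: fib_morph.cases) auto
    have "c = d \<and> fib_morph w' = fib_morph z @ LA # s"
      using Cons.prems w not_LB[of w'] not_LB[of z]
      by (cases c; cases d; cases z rule: fib_morph.cases) auto
    then show ?thesis using Cons.IH w by simp
  qed
qed

text \<open>In a product of blocks, \<open>LB\<close> occurs only as the second letter of
  \<open>ab\<close>.\<close>

lemma fib_morph_LB_preceded:
  "fib_morph w = p @ LB # s \<Longrightarrow> \<exists>q. p = q @ [LA]"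
proof (induction w arbitrary: p rule: fib_morph.induct)
  case 1
  then show ?case by simp
next
  case (2 w)
  then have "p = [LA] \<or> (\<exists>q. p = LA # LB # q \<and> fib_morph w = q @ LB # s)"
    by (auto simp: Cons_eq_append_conv)
  then show ?case using "2.IH" by fastforce
next
  case (3 w)
  then obtain q where "p = LA # q" "fib_morph w = q @ LB # s"
    by (cases p) auto
  then show ?case using "3.IH" by fastforce
qed

section \<open>Factors of circular words and of their images\<close>

lemma circ_factorsE:
  assumes "x \<in> circ_factors w"
  obtains k p s where "word_power w k = p @ x @ s"
  using assms by (auto simp: circ_factors_def sublist_def)

lemma circ_factorsI: "word_power w k = p @ x @ s \<Longrightarrow> x \<in> circ_factors w"
  by (auto simp: circ_factors_def sublist_def)

lemma circ_factors_infix: "p @ x @ s \<in> circ_factors w \<Longrightarrow> x \<in> circ_factors w"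
  by (auto simp: circ_factors_def dest: sublist_order.order.trans[OF sublist_appendI])

text \<open>One more copy of \<open>w\<close> supplies a next letter even when the occurrence ends
  its power.\<close>

lemma circ_factors_extend:
  assumes "x \<in> circ_factors w" "w \<noteq> []"
  obtains y where "x @ [y] \<in> circ_factors w"
proof -
  from assms(1) obtain k p s where "word_power w k = p @ x @ s"
    by (rule circ_factorsE)
  moreover have "word_power w (Suc k) = word_power w k @ w"
    by (induction k) (auto simp: word_power_def)
  ultimately have "word_power w (Suc k) = p @ x @ (s @ w)"
    by simp
  moreover obtain y t where "s @ w = y # t"
    using assms(2) by (cases "s @ w") auto
  ultimately have "word_power w (Suc k) = p @ (x @ [y]) @ t"
    by simp
  then show ?thesis using that circ_factorsI by blast
qed

lemma singleton_circ_factors_iff: "[x] \<in> circ_factors w \<longleftrightarrow> x \<in> set w"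
proof
  assume "[x] \<in> circ_factors w"
  then obtain k p s where "word_power w k = p @ [x] @ s"
    by (rule circ_factorsE)
  then have "x \<in> set (word_power w k)" by simp
  then show "x \<in> set w" by (auto simp: word_power_def)
next
  assume "x \<in> set w"
  then obtain p s where "w = p @ x # s" by (auto simp: in_set_conv_decomp)
  then show "[x] \<in> circ_factors w"
    by (intro circ_factorsI[of w 1 p _ s]) (simp add: word_power_def)
qed

lemma fib_morph_append_LA_circ_factors_iff:
  assumes "w \<noteq> []"
  shows "fib_morph z @ [LA] \<in> circ_factors (fib_morph w) \<longleftrightarrow> z \<in> circ_factors w"
proof
  assume "fib_morph z @ [LA] \<in> circ_factors (fib_morph w)"
  then obtain k p s where "word_power (fib_morph w) k = p @ (fib_morph z @ [LA]) @ s"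
    by (rule circ_factorsE)
  then have eq: "fib_morph (word_power w k) = p @ fib_morph z @ LA # s"
    by (simp add: fib_morph_word_power)
  \<comment> \<open>Even for empty \<open>z\<close> the word starts with \<open>LA\<close>, so the
    cut after \<open>p\<close> lies between blocks.\<close>
  moreover obtain t where t: "fib_morph z @ LA # s = LA # t"
    by (cases z rule: fib_morph.cases) auto
  ultimately obtain p' s' where ps: "word_power w k = p' @ s'" "fib_morph s' = LA # t"
    by (metis fib_morph_eq_append_LA)
  then have "prefix z s'"
    using t fib_morph_append_LA_prefix by metis
  then show "z \<in> circ_factors w"
    using ps(1) by (auto simp: prefix_def intro: circ_factorsI)
next
  assume "z \<in> circ_factors w"
  \<comment> \<open>The block of the letter following \<open>z\<close> supplies the final
    \<open>LA\<close>, as both blocks start with it.\<close>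
  then obtain y where "z @ [y] \<in> circ_factors w"
    using assms by (rule circ_factors_extend)
  then obtain k p s where "word_power w k = p @ (z @ [y]) @ s"
    by (rule circ_factorsE)
  then have "word_power (fib_morph w) k
      = fib_morph p @ (fib_morph z @ fib_morph [y]) @ fib_morph s"
    by (metis fib_morph_word_power fib_morph_append)
  moreover obtain t where "fib_morph [y] = [LA] @ t"
    by (cases y) auto
  ultimately have "word_power (fib_morph w) k
      = fib_morph p @ (fib_morph z @ [LA]) @ (t @ fib_morph s)"
    by simp
  then show "fib_morph z @ [LA] \<in> circ_factors (fib_morph w)"
    by (rule circ_factorsI)
qed

text \<open>No power of \<open>fib_morph w\<close> starts with \<open>LB\<close>, so an
  \<open>LA\<close> precedes each \<open>LB\<close>, either inside the factor or just before
  it.\<close>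

lemma circ_factors_fib_morph_LB_left:
  assumes "p @ LB # v \<in> circ_factors (fib_morph w)"
  shows "p = [] \<or> (\<exists>q. p = q @ [LA])" "p = [] \<Longrightarrow> LA # LB # v \<in> circ_factors (fib_morph w)"
proof -
  obtain k q s where k: "word_power (fib_morph w) k = q @ (p @ LB # v) @ s"
    using assms by (rule circ_factorsE)
  then have "fib_morph (word_power w k) = (q @ p) @ LB # (v @ s)"
    by (simp add: fib_morph_word_power)
  then obtain r where r: "q @ p = r @ [LA]"
    using fib_morph_LB_preceded by blast
  show "p = [] \<or> (\<exists>q. p = q @ [LA])"
    using r by (cases p rule: rev_cases) auto
  show "LA # LB # v \<in> circ_factors (fib_morph w)" if "p = []"
    using k r that by (intro circ_factorsI[of _ k r _ s]) simp
qed

lemma LB_LB_not_circ_factor: "[LB, LB] \<notin> circ_factors (fib_morph w)"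
  using circ_factors_fib_morph_LB_left(1)[of "[LB]" "[]" w] by auto

lemma circ_factors_fib_morph_LB_right:
  assumes "v @ [LB] \<in> circ_factors (fib_morph w)" "w \<noteq> []"
  shows "v @ [LB, LA] \<in> circ_factors (fib_morph w)"
proof -
  obtain y where y: "(v @ [LB]) @ [y] \<in> circ_factors (fib_morph w)"
    using assms by (metis circ_factors_extend fib_morph_eq_Nil_iff)
  then have "y = LA"
    using circ_factors_infix[of v "[LB, LB]" "[]"] LB_LB_not_circ_factor by (cases y) auto
  with y show ?thesis by simp
qed

text \<open>\<open>fib_morph [flip x]\<close> is the block ending in \<open>x\<close>, so a leading
  letter can be completed to a block.\<close>

lemma Cons_circ_factors_fib_morph_iff:
  "x # v \<in> circ_factors (fib_morph w) \<longleftrightarrow> fib_morph [flip x] @ v \<in> circ_factors (fib_morph w)"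
proof (cases x)
  case LA
  then show ?thesis by simp
next
  case LB
  have "LB # v \<in> circ_factors (fib_morph w) \<longleftrightarrow> LA # LB # v \<in> circ_factors (fib_morph w)"
    using circ_factors_fib_morph_LB_left(2)[of "[]" v w]
      circ_factors_infix[of "[LA]" "LB # v" "[]" "fib_morph w"] by fastforce
  with LB show ?thesis by simp
qed

text \<open>The letter \<open>y\<close> after \<open>LA\<close> reveals which block that
  \<open>LA\<close> starts, namely \<open>fib_morph [flip y]\<close>; the last \<open>LA\<close>
  opens the next block.\<close>

lemma snoc_circ_factors_fib_morph_iff:
  assumes "w \<noteq> []"
  shows "v @ [LA, y] \<in> circ_factors (fib_morph w) \<longleftrightarrow>
    v @ fib_morph [flip y] @ [LA] \<in> circ_factors (fib_morph w)"
proof (cases y)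
  case LA
  then show ?thesis by simp
next
  case LB
  have "v @ [LA, LB] \<in> circ_factors (fib_morph w) \<longleftrightarrow>
      v @ [LA, LB, LA] \<in> circ_factors (fib_morph w)"
    using circ_factors_fib_morph_LB_right[of "v @ [LA]" w] assms
      circ_factors_infix[of "[]" "v @ [LA, LB]" "[LA]" "fib_morph w"] by fastforce
  with LB show ?thesis by simp
qed

section \<open>Minimal forbidden factors under the morphism\<close>

definition minimal_forbidden_triple :: "'a list set \<Rightarrow> 'a \<Rightarrow> 'a list \<Rightarrow> 'a \<Rightarrow> bool" where
  "minimal_forbidden_triple L x u y \<longleftrightarrow>
     [x] @ u @ [y] \<notin> L \<and> [x] @ u \<in> L \<and> u @ [y] \<in> L"

text \<open>Completing the outer letters to blocks brings each of the three words into the form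
  \<open>fib_morph z @ [LA]\<close>, which can be decoded.\<close>

lemma minimal_forbidden_triple_fib_morph_append_LA:
  assumes "w \<noteq> []"
  shows "minimal_forbidden_triple (circ_factors (fib_morph w)) x (fib_morph u @ [LA]) y \<longleftrightarrow>
    minimal_forbidden_triple (circ_factors w) (flip x) u (flip y)"
proof -
  note decode = fib_morph_append_LA_circ_factors_iff[OF assms]
  have left: "[x] @ fib_morph u @ [LA] \<in> circ_factors (fib_morph w) \<longleftrightarrow>
      [flip x] @ u \<in> circ_factors w"
    using decode[of "[flip x] @ u"] Cons_circ_factors_fib_morph_iff[of x "fib_morph u @ [LA]" w]
    by (cases x) simp_all
  have right: "(fib_morph u @ [LA]) @ [y] \<in> circ_factors (fib_morph w) \<longleftrightarrow>
      u @ [flip y] \<in> circ_factors w"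
    using decode[of "u @ [flip y]"] snoc_circ_factors_fib_morph_iff[OF assms, of "fib_morph u" y]
    by (cases y) simp_all
  have both: "[x] @ (fib_morph u @ [LA]) @ [y] \<in> circ_factors (fib_morph w) \<longleftrightarrow>
      [flip x] @ u @ [flip y] \<in> circ_factors w"
    using decode[of "[flip x] @ u @ [flip y]"]
      Cons_circ_factors_fib_morph_iff[of x "fib_morph u @ [LA, y]" w]
      snoc_circ_factors_fib_morph_iff[OF assms, of "fib_morph [flip x] @ fib_morph u" y]
    by (cases x; cases y) simp_all
  show ?thesis
    unfolding minimal_forbidden_triple_def left right both ..
qed

text \<open>If \<open>v\<close> started or ended with \<open>LB\<close>, the adjacent outer letter
  would be forced to be \<open>LA\<close>, and the forbidden word would be a factor after
  all.\<close>

lemma minimal_forbidden_triple_fib_morph_decode: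
  assumes "w \<noteq> []" "v \<noteq> []"
    and mf: "minimal_forbidden_triple (circ_factors (fib_morph w)) x v y"
  obtains u where "v = fib_morph u @ [LA]"
proof -
  let ?L = "circ_factors (fib_morph w)"
  have mf': "x # v @ [y] \<notin> ?L" "x # v \<in> ?L" "v @ [y] \<in> ?L"
    using mf by (auto simp: minimal_forbidden_triple_def)
  have "hd v = LA"
  proof (rule ccontr)
    assume "hd v \<noteq> LA"
    with \<open>v \<noteq> []\<close> obtain v' where v: "v = LB # v'" by (cases v) auto
    have "x = LA"
      using circ_factors_fib_morph_LB_left(1)[of "[x]" v' w] mf'(2) v by auto
    then show False
      using circ_factors_fib_morph_LB_left(2)[of "[]" "v' @ [y]" w] mf' v by auto
  qed
  then obtain v1 where v1: "v = LA # v1"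
    using \<open>v \<noteq> []\<close> by (cases v) auto
  have "last v = LA"
  proof (rule ccontr)
    assume "last v \<noteq> LA"
    with \<open>v \<noteq> []\<close> obtain v' where v: "v = v' @ [LB]" by (cases v rule: rev_cases) auto
    have "y = LA"
      using circ_factors_infix[of v' "[LB, LB]" "[]"] LB_LB_not_circ_factor mf'(3) v
      by (cases y) auto
    then show False
      using circ_factors_fib_morph_LB_right[of "x # v'" w] mf' v assms(1) by auto
  qed
  then obtain v0 where v0: "v = v0 @ [LA]"
    using \<open>v \<noteq> []\<close> by (metis append_butlast_last_id)
  obtain k p s where "word_power (fib_morph w) k = p @ (v @ [y]) @ s"
    using mf'(3) by (rule circ_factorsE)
  then have "fib_morph (word_power w k) = p @ LA # (v1 @ [y] @ s)"
    using v1 by (simp add: fib_morph_word_power)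
  \<comment> \<open>The first \<open>LA\<close> of \<open>v\<close> gives the left block boundary,
    the last one the right boundary.\<close>
  then obtain t where "fib_morph t = LA # (v1 @ [y] @ s)"
    by (metis fib_morph_eq_append_LA)
  then have "fib_morph t = v0 @ LA # ([y] @ s)"
    using v0 v1 by (metis append.assoc append_Cons append_Nil)
  then obtain u where "fib_morph u = v0"
    by (metis fib_morph_eq_append_LA)
  with v0 that show ?thesis by blast
qed

lemma set_fib_morph: "LA \<in> set (fib_morph w) \<longleftrightarrow> w \<noteq> []" "LB \<in> set (fib_morph w) \<longleftrightarrow> LA \<in> set w"
  by (induction w rule: fib_morph.induct) auto

lemma minimal_forbidden_triple_fib_morph_Nil:
  assumes "LA \<in> set w"
  shows "minimal_forbidden_triple (circ_factors (fib_morph w)) x [] y \<longleftrightarrow>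
    x = y \<and> (x = LB \<or> LB \<notin> set w)"
proof -
  have "w \<noteq> []" using assms by auto
  have letters: "[z] \<in> circ_factors (fib_morph w)" for z
    using assms \<open>w \<noteq> []\<close> by (cases z) (auto simp: singleton_circ_factors_iff set_fib_morph)
  have "[LB, LA] \<in> circ_factors (fib_morph w)"
    using circ_factors_fib_morph_LB_right[of "[]"] letters \<open>w \<noteq> []\<close> by simp
  moreover have "[LA, LB] \<in> circ_factors (fib_morph w)"
    using circ_factors_fib_morph_LB_left(2)[of "[]" "[]"] letters by simp
  \<comment> \<open>\<open>[LA, LA]\<close> is \<open>fib_morph [LB] @ [LA]\<close>.\<close>
  moreover have "[LA, LA] \<in> circ_factors (fib_morph w) \<longleftrightarrow> LB \<in> set w"
    using fib_morph_append_LA_circ_factors_iff[OF \<open>w \<noteq> []\<close>, of "[LB]"]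
    by (simp add: singleton_circ_factors_iff)
  ultimately show ?thesis
    using letters LB_LB_not_circ_factor
    by (cases x; cases y) (auto simp: minimal_forbidden_triple_def)
qed

lemma minimal_forbidden_triple_fib_morph:
  assumes "LA \<in> set w"
  shows "minimal_forbidden_triple (circ_factors (fib_morph w)) x v y \<longleftrightarrow>
    v = [] \<and> x = y \<and> (x = LB \<or> LB \<notin> set w) \<or>
    (\<exists>u. v = fib_morph u @ [LA] \<and> minimal_forbidden_triple (circ_factors w) (flip x) u (flip y))"
proof (cases "v = []")
  case True
  then show ?thesis using minimal_forbidden_triple_fib_morph_Nil[OF assms] by simp
next
  case False
  have "w \<noteq> []" using assms by auto
  from minimal_forbidden_triple_fib_morph_decode[OF this False]
    minimal_forbidden_triple_fib_morph_append_LA[OF this] False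
  show ?thesis by metis
qed

section \<open>Induction along the Fibonacci words\<close>

lemma circ_factors_LA: "x \<in> circ_factors [LA] \<longleftrightarrow> set x \<subseteq> {LA}"
proof
  assume "x \<in> circ_factors [LA]"
  then show "set x \<subseteq> {LA}"
    by (auto simp: circ_factors_def word_power_def dest!: set_mono_sublist)
next
  assume "set x \<subseteq> {LA}"
  then have "x = word_power [LA] (length x)"
    by (induction x) (auto simp: word_power_def)
  then show "x \<in> circ_factors [LA]"
    by (auto simp: circ_factors_def intro!: exI[of _ "length x"])
qed

lemma letters_fib_word: "n \<ge> 3 \<Longrightarrow> x \<in> set (fib_word n)"
  using fib_word_ends[of n] by (cases x) auto

lemma minimal_forbidden_triple_fib_word:
  assumes "n \<ge> 3"
  shows "minimal_forbidden_triple (circ_factors (fib_word n)) x v y \<longleftrightarrow>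
    x = y \<and> ((\<exists>i\<in>{3..n}. v = fib_u i \<and> x = (if odd i then LB else LA)) \<or>
      v = fib_u n \<and> x = (if odd n then LA else LB))"
  using assms
proof (induction n arbitrary: x v y rule: dec_induct)
  case base
  have "fib_word 3 = fib_morph [LA]" and u3: "fib_u 3 = []"
    by (simp_all add: fib_u_def numeral_3_eq_3)
  \<comment> \<open>In \<open>[LA]\<close> only the single letter \<open>LB\<close> is minimal
    forbidden, so only the empty core contributes, with both letters.\<close>
  moreover have "\<not> minimal_forbidden_triple (circ_factors [LA]) x' u y'" for x' u y'
    by (auto simp: minimal_forbidden_triple_def circ_factors_LA)
  ultimately show ?case
    using minimal_forbidden_triple_fib_morph[of "[LA]"] by (cases x) auto
next
  case (step n)
  have u3: "fib_u 3 = []"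
    by (simp add: fib_u_def numeral_3_eq_3)
  have "fib_word (Suc n) = fib_morph (fib_word n)"
    using fib_morph_fib_word[of n] step.hyps by simp
  then have "minimal_forbidden_triple (circ_factors (fib_word (Suc n))) x v y \<longleftrightarrow>
      v = [] \<and> x = LB \<and> y = LB \<or>
      (\<exists>u. v = fib_morph u @ [LA] \<and> flip x = flip y \<and>
        ((\<exists>i\<in>{3..n}. u = fib_u i \<and> flip x = (if odd i then LB else LA)) \<or>
          u = fib_u n \<and> flip x = (if odd n then LA else LB)))"
    using minimal_forbidden_triple_fib_morph[of "fib_word n"] letters_fib_word[OF step.hyps(1)]
    by (auto simp: step.IH)
  \<comment> \<open>\<open>flip\<close> compensates for the change of parity from \<open>i\<close>
    to \<open>Suc i\<close>.\<close>
  also have "\<dots> \<longleftrightarrow> x = y \<and> (v = [] \<and> x = LB \<or>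
      (\<exists>i\<in>{3..n}. v = fib_u (Suc i) \<and> x = (if odd (Suc i) then LB else LA)) \<or>
      v = fib_u (Suc n) \<and> x = (if odd (Suc n) then LA else LB))"
    using fib_u_Suc step.hyps(1) by (cases x; cases y) auto
  \<comment> \<open>The new word \<open>bb\<close> becomes the entry at index 3, because
    \<open>fib_u 3\<close> is empty.\<close>
  also have "\<dots> \<longleftrightarrow> x = y \<and>
      ((\<exists>i\<in>insert 3 (Suc ` {3..n}). v = fib_u i \<and> x = (if odd i then LB else LA)) \<or>
        v = fib_u (Suc n) \<and> x = (if odd (Suc n) then LA else LB))"
    unfolding bex_simps by (simp add: u3)
  also have "insert 3 (Suc ` {3..n}) = {3..Suc n}"
    using step.hyps by auto
  finally show ?case .
qed

theorem theorem7:
  fixes n :: nat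
  assumes "n \<ge> 4"
  shows "circ_min_forbidden (fib_word n) = hat_g ` {3..n} \<union> {hat_f n}"
proof -
  have n: "n \<ge> 3" using assms by simp
  \<comment> \<open>Both letters occur in \<open>fib_word n\<close>, so no single letter is
    forbidden.\<close>
  have "circ_min_forbidden (fib_word n) =
      {[x] @ u @ [y] | x u y. minimal_forbidden_triple (circ_factors (fib_word n)) x u y}"
    using letters_fib_word[OF n]
    by (auto simp: circ_min_forbidden_def min_forbidden_def minimal_forbidden_triple_def
        singleton_circ_factors_iff)
  also have "\<dots> = hat_g ` {3..n} \<union> {hat_f n}"
    unfolding minimal_forbidden_triple_fib_word[OF n]
    by (auto simp: hat_g_def hat_f_def image_iff)
  finally show ?thesis .
qed

end
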